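(* Let $\mathcal{X}$ be a complete real inner product space (of sequences) with extension $\mathcal{X}_e$, and let $(\Omega,\mathcal{F},\mathbb{P})$ be a complete probability space from which samples $w_0,w_1,\dots$ are drawn, any two samples $w_i,w_j\in\Omega$ being independent and identically distributed. Let $Q\in\mathbb{S}^m$, $S\in\mathbb{R}^{m\times n}$, $R\in\mathbb{S}^n$. If $G:\mathcal{X}_e^n\times\mathcal{F}\to\mathcal{X}_e^m$ is stochastically dissipative, i.e. $(Q,S,R)$-dissipative-in-expectation, with $Q\prec 0$, then $G$ is stochastically input-output stable on $\mathcal{X}$.
   Context: Notation: $\mathbb{S}^n$ denotes the real symmetric $n\times n$ matrices; $\prec$ denotes negative definiteness. $\mathcal{X}$ is a real inner product space of sequences; it is called complete if $\|x\|_{\mathcal X}^2:=\langle x,x\rangle<\infty$ for all $x\in\mathcal X$. $\mathcal{X}^n$ is the corresponding space of $n$-dimensional vector sequences $x:\mathbb{Z}\to\mathbb{R}^n$, with $\langle x,y\rangle=\sum_{i}\langle x_i,y_i\rangle$ over components; real matrices act on vector sequences pointwise in time. The truncation $x_{[T]}$ of $x$ is $x_{[T]}(k)=x(k)$ for $k\le T$ and $x_{[T]}(k)=0$ for $k>T$. The extension $\mathcal{X}_e$ consists of the sequences $x$ with $\|x_{[T]}\|_{\mathcal X}^2<\infty$ for all $T\ge 0$. The truncated inner product is $\langle x,y\rangle_{[T]}=\langle x_{[T]},y_{[T]}\rangle$. The second argument of $G$ is a sequence of samples; $w_{[T]}$ denotes the sequence of samples from time $0$ to time $T$, and $\mathbb{E}_{w_{[T]}\sim\mathbb{P}}$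 is the expectation over these samples. Outputs $G(u_{[T]},w_{[T]})$ appearing in inner products and norms below are considered up to time $T$ (truncated at $T$), and all expectations are assumed well defined. $(Q,S,R)$-dissipativity-in-expectation (stochastic dissipativity): there exists $\beta\in\mathbb{R}$ (possibly a function of initial conditions) such that for all $T\in\mathbb{Z}_{(0,\infty)}$ and all $u\in\mathcal{X}_e^n$, $$\mathbb{E}_{w_{[T]}\sim\mathbb{P}}\left(\left\langle \xi,\begin{bmatrix}Q&S\\S^T&R\end{bmatrix}\xi\right\rangle\right)\ge\beta,\qquad \xi^T=\begin{bmatrix}G^T(u_{[T]},w_{[T]}) & u_{[T]}^T\end{bmatrix}.$$ Stochastic input-output stability (input-output stability-in-expectation) on $\mathcal X$: there exist $\beta\in\mathbb{R}$ (possibly depending on initial conditions) and $\gamma\in\mathbb{R}_{(0,\infty)}$ such that for all $u\in\mathcal{X}^n$ and all $T\in\mathbb{Z}_{(0,\infty)}$, $\mathbb{E}_{w_{[T]}\sim\mathbb{P}}\big(\|G(u_{[T]},w_{[T]})\|_{\mathcal X}^2\big)\le\gamma\|u_{[T]}\|_{\mathcal X}^2+\beta$. *)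

theory Defs
  imports "HOL-Probability.Probability"
begin

text \<open>
  Signals are two-sided sequences indexed by \<open>int\<close>. The inner product of a sequence space \<open>X\<close> is
  extended-real valued, because completeness of \<open>X\<close> is the demand that \<open>\<langle>x, x\<rangle>\<close> be finite on all
  of \<open>X\<close>. The inner product laws are imposed where the induced norm is finite, so for a complete
  space they hold on all of \<open>X\<close>.
\<close>

definition linear_seq_set :: "(int \<Rightarrow> real) set \<Rightarrow> bool" where
  "linear_seq_set V \<longleftrightarrow>
     (\<lambda>k. 0) \<in> V \<and>
     (\<forall>x\<in>V. \<forall>y\<in>V. (\<lambda>k. x k + y k) \<in> V) \<and>
     (\<forall>c. \<forall>x\<in>V. (\<lambda>k. c * x k) \<in> V)"

definition seq_inner_space ::
    "(int \<Rightarrow> real) set \<Rightarrow> ((int \<Rightarrow> real) \<Rightarrow> (int \<Rightarrow> real) \<Rightarrow> ereal) \<Rightarrow> bool" where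
  "seq_inner_space X ip \<longleftrightarrow>
     linear_seq_set X \<and>
     (\<forall>x\<in>X. 0 \<le> ip x x) \<and>
     (let F = {x \<in> X. ip x x < \<infinity>} in
       linear_seq_set F \<and>
       (\<forall>x\<in>F. ip x x = 0 \<longrightarrow> x = (\<lambda>k. 0)) \<and>
       (\<forall>x\<in>F. \<forall>y\<in>F. \<bar>ip x y\<bar> \<noteq> \<infinity> \<and> ip x y = ip y x) \<and>
       (\<forall>x\<in>F. \<forall>y\<in>F. \<forall>z\<in>F. ip (\<lambda>k. x k + y k) z = ip x z + ip y z) \<and>
       (\<forall>c. \<forall>x\<in>F. \<forall>y\<in>F. ip (\<lambda>k. c * x k) y = ereal c * ip x y))"

definition complete_seq_space ::
    "(int \<Rightarrow> real) set \<Rightarrow> ((int \<Rightarrow> real) \<Rightarrow> (int \<Rightarrow> real) \<Rightarrow> ereal) \<Rightarrow> bool" where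
  "complete_seq_space X ip \<longleftrightarrow> (\<forall>x\<in>X. ip x x < \<infinity>)"

text \<open>The norm of \<open>X\<close> is \<open>\<infinity>\<close> at sequences that do not belong to \<open>X\<close>.\<close>

definition sq_norm ::
    "(int \<Rightarrow> real) set \<Rightarrow> ((int \<Rightarrow> real) \<Rightarrow> (int \<Rightarrow> real) \<Rightarrow> ereal) \<Rightarrow> (int \<Rightarrow> real) \<Rightarrow> ereal" where
  "sq_norm X ip x = (if x \<in> X then ip x x else \<infinity>)"

definition trunc :: "int \<Rightarrow> (int \<Rightarrow> 'a::zero) \<Rightarrow> int \<Rightarrow> 'a" where
  "trunc T x = (\<lambda>k. if k \<le> T then x k else 0)"

definition extension ::
    "(int \<Rightarrow> real) set \<Rightarrow> ((int \<Rightarrow> real) \<Rightarrow> (int \<Rightarrow> real) \<Rightarrow> ereal) \<Rightarrow> (int \<Rightarrow> real) set" where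
  "extension X ip = {x. \<forall>T\<ge>0. sq_norm X ip (trunc T x) < \<infinity>}"

definition component :: "'n \<Rightarrow> (int \<Rightarrow> real^'n) \<Rightarrow> int \<Rightarrow> real" where
  "component i x = (\<lambda>k. x k $ i)"

definition vec_seqs :: "(int \<Rightarrow> real) set \<Rightarrow> (int \<Rightarrow> real^'n) set" where
  "vec_seqs X = {x. \<forall>i. component i x \<in> X}"

definition vec_inner ::
    "((int \<Rightarrow> real) \<Rightarrow> (int \<Rightarrow> real) \<Rightarrow> ereal) \<Rightarrow> (int \<Rightarrow> real^'n) \<Rightarrow> (int \<Rightarrow> real^'n) \<Rightarrow> ereal" where
  "vec_inner ip x y = (\<Sum>i\<in>UNIV. ip (component i x) (component i y))"

definition vec_sq_norm ::
    "(int \<Rightarrow> real) set \<Rightarrow> ((int \<Rightarrow> real) \<Rightarrow> (int \<Rightarrow> real) \<Rightarrow> ereal) \<Rightarrow> (int \<Rightarrow> real^'n) \<Rightarrow> ereal" where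
  "vec_sq_norm X ip x = (\<Sum>i\<in>UNIV. sq_norm X ip (component i x))"

definition symmetric_matrix :: "real^'n^'n \<Rightarrow> bool" where
  "symmetric_matrix A \<longleftrightarrow> transpose A = A"

definition negative_definite :: "real^'n^'n \<Rightarrow> bool" where
  "negative_definite A \<longleftrightarrow> symmetric_matrix A \<and> (\<forall>x. x \<noteq> 0 \<longrightarrow> x \<bullet> (A *v x) < 0)"

definition supply_matrix ::
    "real^'m^'m \<Rightarrow> real^'n^'m \<Rightarrow> real^'n^'n \<Rightarrow> real^('m + 'n)^('m + 'n)" where
  "supply_matrix Q S R = (\<chi> i j.
     case i of
       Inl a \<Rightarrow> (case j of Inl b \<Rightarrow> Q $ a $ b | Inr b \<Rightarrow> S $ a $ b)
     | Inr a \<Rightarrow> (case j of Inl b \<Rightarrow> transpose S $ a $ b | Inr b \<Rightarrow> R $ a $ b))"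

definition stack :: "(int \<Rightarrow> real^'m) \<Rightarrow> (int \<Rightarrow> real^'n) \<Rightarrow> int \<Rightarrow> real^('m + 'n)" where
  "stack y u = (\<lambda>k. \<chi> i. case i of Inl a \<Rightarrow> y k $ a | Inr b \<Rightarrow> u k $ b)"

text \<open>
  The samples are realised as random variables \<open>W i\<close> on an arbitrary probability space \<open>N\<close>, each
  distributed according to \<open>P\<close>. Independence is required of any two of them.
\<close>

definition iid_samples :: "'o measure \<Rightarrow> 'w measure \<Rightarrow> (nat \<Rightarrow> 'o \<Rightarrow> 'w) \<Rightarrow> bool" where
  "iid_samples N P W \<longleftrightarrow>
     prob_space N \<and>
     (\<forall>i. W i \<in> measurable N P \<and> distr N P (W i) = P) \<and>
     (\<forall>i j. i \<noteq> j \<longrightarrow> prob_space.indep_var N P (W i) P (W j))"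

definition samples_upto :: "(nat \<Rightarrow> 'o \<Rightarrow> 'w) \<Rightarrow> int \<Rightarrow> 'o \<Rightarrow> 'w list" where
  "samples_upto W T \<omega> = map (\<lambda>k. W k \<omega>) [0..<Suc (nat T)]"

definition trunc_output ::
    "((int \<Rightarrow> real^'n) \<Rightarrow> 'w list \<Rightarrow> int \<Rightarrow> real^'m) \<Rightarrow> (nat \<Rightarrow> 'o \<Rightarrow> 'w)
      \<Rightarrow> (int \<Rightarrow> real^'n) \<Rightarrow> int \<Rightarrow> 'o \<Rightarrow> int \<Rightarrow> real^'m" where
  "trunc_output G W u T \<omega> = trunc T (G (trunc T u) (samples_upto W T \<omega>))"

definition supply_rate ::
    "((int \<Rightarrow> real) \<Rightarrow> (int \<Rightarrow> real) \<Rightarrow> ereal) \<Rightarrow> real^'m^'m \<Rightarrow> real^'n^'m \<Rightarrow> real^'n^'n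
      \<Rightarrow> (int \<Rightarrow> real^'m) \<Rightarrow> (int \<Rightarrow> real^'n) \<Rightarrow> ereal" where
  "supply_rate ip Q S R y u =
     vec_inner ip (stack y u) (\<lambda>k. supply_matrix Q S R *v stack y u k)"

text \<open>
  Integrability says that the expectation is well defined. In a complete space the supply is finite
  for all arguments that occur here, so that \<open>real_of_ereal\<close> loses nothing.
\<close>

definition stoch_dissipative ::
    "(int \<Rightarrow> real) set \<Rightarrow> ((int \<Rightarrow> real) \<Rightarrow> (int \<Rightarrow> real) \<Rightarrow> ereal) \<Rightarrow> 'o measure
      \<Rightarrow> (nat \<Rightarrow> 'o \<Rightarrow> 'w) \<Rightarrow> real^'m^'m \<Rightarrow> real^'n^'m \<Rightarrow> real^'n^'n
      \<Rightarrow> ((int \<Rightarrow> real^'n) \<Rightarrow> 'w list \<Rightarrow> int \<Rightarrow> real^'m) \<Rightarrow> bool" where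
  "stoch_dissipative X ip N W Q S R G \<longleftrightarrow>
     (\<exists>\<beta>::real. \<forall>T>0. \<forall>u \<in> vec_seqs (extension X ip).
        integrable N (\<lambda>\<omega>. real_of_ereal (supply_rate ip Q S R (trunc_output G W u T \<omega>) (trunc T u))) \<and>
        \<beta> \<le> (\<integral>\<omega>. real_of_ereal (supply_rate ip Q S R (trunc_output G W u T \<omega>) (trunc T u)) \<partial>N))"

text \<open>
  The expectation of the nonnegative squared norm is taken in \<open>[0, \<infinity>]\<close>; the stability bound
  includes its finiteness.
\<close>

definition stoch_io_stable ::
    "(int \<Rightarrow> real) set \<Rightarrow> ((int \<Rightarrow> real) \<Rightarrow> (int \<Rightarrow> real) \<Rightarrow> ereal) \<Rightarrow> 'o measure
      \<Rightarrow> (nat \<Rightarrow> 'o \<Rightarrow> 'w) \<Rightarrow> ((int \<Rightarrow> real^'n) \<Rightarrow> 'w list \<Rightarrow> int \<Rightarrow> real^'m) \<Rightarrow> bool" where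
  "stoch_io_stable X ip N W G \<longleftrightarrow>
     (\<exists>(\<beta>::real) (\<gamma>::real). 0 < \<gamma> \<and>
        (\<forall>u \<in> vec_seqs X. \<forall>T>0.
           enn2ereal (\<integral>\<^sup>+\<omega>. e2ennreal (vec_sq_norm X ip (trunc_output G W u T \<omega>)) \<partial>N)
             \<le> ereal \<gamma> * vec_sq_norm X ip (trunc T u) + ereal \<beta>))"

end

theory Submission
  imports Defs
begin

text \<open>
  Negative definiteness of \<open>Q\<close> lets Young's inequality absorb the cross term, so that the supply
  matrix is dominated by \<open>diag (-c, C)\<close> in the Loewner order for some \<open>c, C > 0\<close>. The Loewner
  inequality passes from real vectors to vectors of signals because a positive semidefinite matrix
  is a Gram matrix \<open>L\<^sup>T L\<close>. Hence pointwise \<open>c \<parallel>y\<parallel>\<^sup>2 \<le> C \<parallel>u\<parallel>\<^sup>2 - supply\<close>, and taking expectations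
  gives the claim.
\<close>

section \<open>Gram factorisation of positive semidefinite matrices\<close>

lemma sum_insert_square:
  fixes f :: "'i \<Rightarrow> 'i \<Rightarrow> 'b::comm_monoid_add"
  assumes "finite I" "k \<notin> I"
  shows "(\<Sum>i\<in>insert k I. \<Sum>j\<in>insert k I. f i j) =
    f k k + (\<Sum>j\<in>I. f k j) + (\<Sum>i\<in>I. f i k) + (\<Sum>i\<in>I. \<Sum>j\<in>I. f i j)"
  using assms by (simp add: sum.distrib add_ac)

text \<open>With a zero at position \<open>k\<close> on the diagonal, the form at the
  \<open>l\<close>-th unit vector plus \<open>s\<close> times the \<open>k\<close>-th one is affine
  in \<open>s\<close>. An affine function bounded below has slope zero.\<close>

lemma psd_zero_diagonal:
  fixes A :: "'i \<Rightarrow> 'i \<Rightarrow> real"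
  assumes "finite I"
    and sym: "\<And>i j. i \<in> I \<Longrightarrow> j \<in> I \<Longrightarrow> A i j = A j i"
    and psd: "\<And>v. 0 \<le> (\<Sum>i\<in>I. \<Sum>j\<in>I. A i j * v i * v j)"
    and "k \<in> I" "l \<in> I" "A k k = 0"
  shows "A l k = 0"
proof (cases "l = k")
  case False
  have form: "0 \<le> A l l + 2 * s * A l k" for s
  proof -
    let ?v = "\<lambda>i. if i = l then 1 else if i = k then s else 0"
    have "(\<Sum>i\<in>I. \<Sum>j\<in>I. A i j * ?v i * ?v j) = (\<Sum>i\<in>{l,k}. \<Sum>j\<in>{l,k}. A i j * ?v i * ?v j)"
      using assms by (intro sum.mono_neutral_cong_right) (auto intro!: sum.mono_neutral_cong_right)
    also have "\<dots> = A l l + 2 * s * A l k"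
      using False assms sym[of k l] by (simp add: algebra_simps)
    finally show ?thesis using psd[of ?v] by simp
  qed
  show ?thesis
  proof (rule ccontr)
    assume "A l k \<noteq> 0"
    then show False
      \<comment> \<open>This \<open>s\<close> is chosen to give the form the value -1.\<close>
      using form[of "- (A l l + 1) / (2 * A l k)"] by (simp add: field_simps)
  qed
qed (use assms in simp)

text \<open>
  Cholesky factorisation by Schur complements. If the pivot vanishes then so does its column, and
  the convention \<open>x / 0 = 0\<close> makes the formulas of the nonzero case remain valid.
\<close>

lemma psd_imp_gram:
  fixes A :: "'i \<Rightarrow> 'i \<Rightarrow> real"
  assumes "finite I"
    and "\<And>i j. i \<in> I \<Longrightarrow> j \<in> I \<Longrightarrow> A i j = A j i"
    and "\<And>v. 0 \<le> (\<Sum>i\<in>I. \<Sum>j\<in>I. A i j * v i * v j)"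
  shows "\<exists>L. \<forall>i\<in>I. \<forall>j\<in>I. A i j = (\<Sum>l\<in>I. L l i * L l j)"
  using assms
proof (induction I arbitrary: A rule: finite_induct)
  case empty
  then show ?case by simp
next
  case (insert k I)
  note sym = insert.prems(1) and psd = insert.prems(2)
  let ?a = "A k k"
  \<comment> \<open>The Schur complement of the pivot, to which the induction hypothesis will be
    applied.\<close>
  define B where "B i j = A i j - A i k * A j k / ?a" for i j
  have zero: "A l k = 0" if "l \<in> I" "?a = 0" for l
    using psd_zero_diagonal[of "insert k I" A k l] insert that by auto
  \<comment> \<open>The pivot is the value of the form at the \<open>k\<close>-th unit vector. Its
    sign is what lets \<open>sqrt ?a\<close> square back to \<open>?a\<close> in
    \<open>pivot\<close>.\<close>
  have nonneg: "0 \<le> ?a"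
  proof -
    let ?v = "\<lambda>i. if i = k then 1 else 0 :: real"
    have "(\<Sum>i\<in>insert k I. \<Sum>j\<in>insert k I. A i j * ?v i * ?v j)
        = (\<Sum>i\<in>{k}. \<Sum>j\<in>{k}. A i j * ?v i * ?v j)"
      using insert.hyps
      by (intro sum.mono_neutral_cong_right) (auto intro!: sum.mono_neutral_cong_right)
    then show ?thesis using psd[of ?v] by simp
  qed
  have B_sym: "B i j = B j i" if "i \<in> I" "j \<in> I" for i j
    using sym[of i j] that by (simp add: B_def)
  have B_psd: "0 \<le> (\<Sum>i\<in>I. \<Sum>j\<in>I. B i j * v i * v j)" for v
  proof -
    define s where "s = (\<Sum>i\<in>I. A i k * v i)"
    \<comment> \<open>For a nonzero pivot this is the minimiser of the form over the
      \<open>k\<close>-th coordinate, and the minimum is the form of \<open>B\<close> at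
      \<open>v\<close>.\<close>
    define w where "w = v(k := - s / ?a)"
    have w: "w i = v i" if "i \<in> I" for i
      using that insert.hyps by (auto simp: w_def)
    have wk: "w k = - s / ?a" by (simp add: w_def)
    have "(\<Sum>j\<in>I. A k j * w k * w j) = w k * s"
      unfolding s_def sum_distrib_left using sym w by (intro sum.cong) auto
    moreover have "(\<Sum>i\<in>I. A i k * w i * w k) = w k * s"
      unfolding s_def sum_distrib_left using w by (intro sum.cong) auto
    moreover have "(\<Sum>i\<in>I. \<Sum>j\<in>I. A i j * w i * w j) = (\<Sum>i\<in>I. \<Sum>j\<in>I. A i j * v i * v j)"
      using w by (intro sum.cong) auto
    ultimately have "0 \<le> ?a * w k * w k + 2 * (w k * s) + (\<Sum>i\<in>I. \<Sum>j\<in>I. A i j * v i * v j)"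
      using psd[of w] unfolding sum_insert_square[OF insert.hyps(1,2)] by (simp add: mult_ac)
    also have "?a * w k * w k + 2 * (w k * s) = - (s * s / ?a)"
      by (cases "?a = 0") (auto simp: wk field_simps)
    also have "- (s * s / ?a) + (\<Sum>i\<in>I. \<Sum>j\<in>I. A i j * v i * v j)
        = (\<Sum>i\<in>I. \<Sum>j\<in>I. B i j * v i * v j)"
      unfolding s_def B_def sum_product sum_divide_distrib sum_negf[symmetric] sum.distrib[symmetric]
      by (intro sum.cong) (auto simp: algebra_simps)
    finally show ?thesis .
  qed
  from insert.IH[of B, OF B_sym B_psd] obtain L
    where L: "\<And>i j. i \<in> I \<Longrightarrow> j \<in> I \<Longrightarrow> B i j = (\<Sum>l\<in>I. L l i * L l j)"
    by blast
  \<comment> \<open>The new row \<open>k\<close> contributes exactly the rank-one matrix subtracted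
    in \<open>B\<close>. The old rows get a zero in column \<open>k\<close>, so they reproduce
    \<open>B\<close> on \<open>I\<close> and leave row and column \<open>k\<close> alone.\<close>
  define L' where "L' l i = (if l = k then A i k / sqrt ?a else if i = k then 0 else L l i)" for l i
  have pivot: "L' k i * L' k j = A i k * A j k / ?a" for i j
    using nonneg by (simp add: L'_def)
  have rest: "(\<Sum>l\<in>I. L' l i * L' l j) = (if i = k \<or> j = k then 0 else \<Sum>l\<in>I. L l i * L l j)"
    for i j using insert.hyps by (auto simp: L'_def intro!: sum.cong sum.neutral)
  have "A i j = (\<Sum>l\<in>insert k I. L' l i * L' l j)" if "i \<in> insert k I" "j \<in> insert k I" for i j
  proof (cases "i = k \<or> j = k")
    case True
    have "A i j = A i k * A j k / ?a"
    proof (cases "?a = 0")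
      case True
      then show ?thesis using zero sym that \<open>i = k \<or> j = k\<close> by auto
    next
      case False
      then show ?thesis using sym that True by auto
    qed
    then show ?thesis using True insert.hyps by (simp add: pivot rest)
  next
    case False
    then have "i \<in> I" "j \<in> I" using that by auto
    from L[OF this] show ?thesis using False insert.hyps by (simp add: pivot rest B_def)
  qed
  then show ?case by blast
qed

section \<open>Diagonal upper bound for the supply matrix\<close>

text \<open>By compactness the form attains its maximum on the unit sphere, and that maximum is
  negative. Homogeneity of degree two extends the bound to all vectors, with minus the maximum as
  \<open>c\<close>.\<close>

lemma negative_definite_bound:
  fixes Q :: "real^'m^'m"
  assumes "negative_definite Q"
  obtains c where "c > 0" "\<And>y. y \<bullet> (Q *v y) \<le> - c * (norm y)\<^sup>2"
proof -
  let ?f = "\<lambda>y. y \<bullet> (Q *v y)"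
  have "continuous_on (sphere 0 1) ?f"
    by (intro continuous_intros linear_continuous_on matrix_vector_mul_bounded_linear)
  moreover have "(axis undefined 1 :: real^'m) \<in> sphere 0 1"
    by simp
  ultimately obtain z where z: "z \<in> sphere 0 1" "\<And>y. y \<in> sphere 0 1 \<Longrightarrow> ?f y \<le> ?f z"
    using continuous_attains_sup[of "sphere 0 1" ?f] by (metis compact_sphere empty_iff)
  show ?thesis
  proof
    have "z \<noteq> 0" using z(1) by auto
    then show "- ?f z > 0"
      using assms by (simp add: negative_definite_def)
    show "?f y \<le> - (- ?f z) * (norm y)\<^sup>2" for y
    proof (cases "y = 0")
      case False
      let ?e = "(1 / norm y) *\<^sub>R y"
      have "?f ?e \<le> ?f z" using False by (intro z) simp
      then have "(norm y)\<^sup>2 * ?f ?e \<le> (norm y)\<^sup>2 * ?f z"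
        by (intro mult_left_mono) auto
      moreover have "(norm y)\<^sup>2 * ?f ?e = ?f y"
        using False by (simp add: matrix_vector_mult_scaleR power2_eq_square)
      ultimately show ?thesis by (simp add: mult.commute)
    qed simp
  qed
qed

lemma matrix_bilinear_bound:
  fixes A :: "real^'n^'m"
  obtains K where "K > 0" "\<And>x y. y \<bullet> (A *v x) \<le> K * norm y * norm x"
proof -
  obtain K where K: "K > 0" "\<And>x. norm (A *v x) \<le> norm x * K"
    using bounded_linear.pos_bounded[OF matrix_vector_mul_bounded_linear[of A]] by blast
  have "y \<bullet> (A *v x) \<le> K * norm y * norm x" for x y
  proof -
    have "y \<bullet> (A *v x) \<le> norm y * norm (A *v x)" by (rule norm_cauchy_schwarz)
    also have "\<dots> \<le> norm y * (norm x * K)" by (intro mult_left_mono K) simp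
    finally show ?thesis by (simp add: mult_ac)
  qed
  with K(1) show ?thesis by (rule that)
qed

lemma sum_UNIV_Plus:
  fixes f :: "'m::finite + 'n::finite \<Rightarrow> 'b::comm_monoid_add"
  shows "(\<Sum>i\<in>UNIV. f i) = (\<Sum>a\<in>UNIV. f (Inl a)) + (\<Sum>b\<in>UNIV. f (Inr b))"
  by (simp add: UNIV_Plus_UNIV[symmetric] sum.Plus del: UNIV_Plus_UNIV)

text \<open>The blocks \<open>S\<close> and \<open>transpose S\<close> contribute the same scalar,
  hence the factor 2. The double sum over index functions is the shape in which
  \<open>psd_rip_nonneg\<close> expects semidefiniteness.\<close>

lemma supply_matrix_quadratic:
  fixes v :: "'m::finite + 'n::finite \<Rightarrow> real"
  defines "y \<equiv> \<chi> a. v (Inl a)" and "u \<equiv> \<chi> b. v (Inr b)"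
  shows "(\<Sum>i\<in>UNIV. \<Sum>j\<in>UNIV. supply_matrix Q S R $ i $ j * v i * v j) =
    y \<bullet> (Q *v y) + 2 * (y \<bullet> (S *v u)) + u \<bullet> (R *v u)"
proof -
  have "u \<bullet> (transpose S *v y) = y \<bullet> (S *v u)"
    by (metis dot_lmul_matrix inner_commute transpose_matrix_vector)
  then have "y \<bullet> (Q *v y) + 2 * (y \<bullet> (S *v u)) + u \<bullet> (R *v u) =
    y \<bullet> (Q *v y) + y \<bullet> (S *v u) + (u \<bullet> (transpose S *v y) + u \<bullet> (R *v u))"
    by simp
  also have "\<dots> = (\<Sum>i\<in>UNIV. \<Sum>j\<in>UNIV. supply_matrix Q S R $ i $ j * v i * v j)"
    by (simp add: sum_UNIV_Plus supply_matrix_def y_def u_def inner_vec_def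
        matrix_vector_mult_def sum_distrib_left sum.distrib mult_ac)
  finally show ?thesis by simp
qed

lemma supply_matrix_symmetric:
  assumes "symmetric_matrix Q" "symmetric_matrix R"
  shows "supply_matrix Q S R $ i $ j = supply_matrix Q S R $ j $ i"
proof -
  have "Q $ a $ b = Q $ b $ a" for a b
    using assms(1) unfolding symmetric_matrix_def by (metis transpose_def vec_lambda_beta)
  moreover have "R $ a $ b = R $ b $ a" for a b
    using assms(2) unfolding symmetric_matrix_def by (metis transpose_def vec_lambda_beta)
  ultimately show ?thesis
    by (auto simp: supply_matrix_def transpose_def split: sum.splits)
qed

text \<open>Half of the coercivity of \<open>Q\<close> absorbs the cross term; the other half
  survives as \<open>c\<close>.\<close>

lemma supply_matrix_dominated:
  fixes Q :: "real^'m^'m" and S :: "real^'n^'m" and R :: "real^'n^'n"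
  assumes "negative_definite Q"
  obtains c C where "c > 0" "C > 0"
    "\<And>v. (\<Sum>i\<in>UNIV. \<Sum>j\<in>UNIV. supply_matrix Q S R $ i $ j * v i * v j)
       \<le> (\<Sum>i\<in>UNIV. (case i of Inl _ \<Rightarrow> - c | Inr _ \<Rightarrow> C) * (v i)\<^sup>2)"
proof -
  obtain c where c: "c > 0" "\<And>y. y \<bullet> (Q *v y) \<le> - c * (norm y)\<^sup>2"
    using negative_definite_bound[OF assms] by blast
  obtain K where K: "K > 0" "\<And>x y. y \<bullet> (S *v x) \<le> K * norm y * norm x"
    using matrix_bilinear_bound by blast
  obtain M where M: "M > 0" "\<And>x y. y \<bullet> (R *v x) \<le> M * norm y * norm x"
    using matrix_bilinear_bound by blast
  \<comment> \<open>The first summand is the price of the cross term in Young's inequality, the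
    second bounds the form of \<open>R\<close>.\<close>
  let ?C = "2 * K\<^sup>2 / c + M"
  have "(\<Sum>i\<in>UNIV. \<Sum>j\<in>UNIV. supply_matrix Q S R $ i $ j * v i * v j)
       \<le> (\<Sum>i\<in>UNIV. (case i of Inl _ \<Rightarrow> - (c / 2) | Inr _ \<Rightarrow> ?C) * (v i)\<^sup>2)" for v
  proof -
    define y where "y = (\<chi> a. v (Inl a))"
    define u where "u = (\<chi> b. v (Inr b))"
    \<comment> \<open>Young's inequality as a completed square, weighted so that the coefficient of
      \<open>(norm y)\<^sup>2\<close> is exactly \<open>c / 2\<close>.\<close>
    have "0 \<le> (c * norm y - 2 * K * norm u)\<^sup>2 / (2 * c)"
      using c(1) by simp
    also have "\<dots> = c / 2 * (norm y)\<^sup>2 + 2 * K\<^sup>2 / c * (norm u)\<^sup>2 - 2 * (K * norm y * norm u)"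
      using c(1) by (simp add: field_simps power2_eq_square)
    finally have "y \<bullet> (Q *v y) + 2 * (y \<bullet> (S *v u)) + u \<bullet> (R *v u)
        \<le> - (c / 2) * (norm y)\<^sup>2 + ?C * (norm u)\<^sup>2"
      using c(2)[of y] K(2)[of y u] M(2)[of u u]
      by (simp add: algebra_simps power2_eq_square)
    also have "\<dots> = (\<Sum>i\<in>UNIV. (case i of Inl _ \<Rightarrow> - (c / 2) | Inr _ \<Rightarrow> ?C) * (v i)\<^sup>2)"
      unfolding power2_norm_eq_inner
      by (simp add: sum_UNIV_Plus y_def u_def inner_vec_def sum_distrib_left power2_eq_square
          del: sum_negf)
    finally show ?thesis
      unfolding supply_matrix_quadratic y_def u_def .
  qed
  then show ?thesis
    \<comment> \<open>Since \<open>M\<close> is strictly positive, so is \<open>?C\<close>, whatever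
      \<open>S\<close> and \<open>R\<close> are; the stability gain will inherit this.\<close>
    using that[of "c / 2" ?C] c(1) M(1) by (simp add: add_nonneg_pos)
qed

section \<open>Real-valued inner product on a complete sequence space\<close>

locale complete_sequence_space =
  fixes X :: "(int \<Rightarrow> real) set" and ip :: "(int \<Rightarrow> real) \<Rightarrow> (int \<Rightarrow> real) \<Rightarrow> ereal"
  assumes inner_space: "seq_inner_space X ip" and complete: "complete_seq_space X ip"
begin

text \<open>Completeness keeps \<open>ip\<close> finite on \<open>X\<close>, so the conversion is
  lossless there and gives access to real arithmetic.\<close>

definition rip :: "(int \<Rightarrow> real) \<Rightarrow> (int \<Rightarrow> real) \<Rightarrow> real" where
  "rip x y = real_of_ereal (ip x y)"

text \<open>The inner product laws are imposed only on the part of finite norm; this rewriting turns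
  them into laws on all of \<open>X\<close>.\<close>

lemma finite_part: "{x \<in> X. ip x x < \<infinity>} = X"
  using complete by (auto simp: complete_seq_space_def)

lemmas inner_laws = inner_space[unfolded seq_inner_space_def Let_def finite_part]

lemma zero_mem: "(\<lambda>k. 0) \<in> X"
  and add_mem: "x \<in> X \<Longrightarrow> y \<in> X \<Longrightarrow> (\<lambda>k. x k + y k) \<in> X"
  and scale_mem: "x \<in> X \<Longrightarrow> (\<lambda>k. c * x k) \<in> X"
  using inner_laws by (auto simp: linear_seq_set_def)

lemma ip_eq_rip: "x \<in> X \<Longrightarrow> y \<in> X \<Longrightarrow> ip x y = ereal (rip x y)"
  using inner_laws by (simp add: rip_def ereal_real')

lemma rip_commute: "x \<in> X \<Longrightarrow> y \<in> X \<Longrightarrow> rip x y = rip y x"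
  using inner_laws by (simp add: rip_def)

lemma rip_nonneg: "x \<in> X \<Longrightarrow> 0 \<le> rip x x"
  using inner_laws by (simp add: rip_def real_of_ereal_pos)

lemma rip_add:
  assumes "x \<in> X" "y \<in> X" "z \<in> X"
  shows "rip (\<lambda>k. x k + y k) z = rip x z + rip y z"
proof -
  have "ip (\<lambda>k. x k + y k) z = ip x z + ip y z"
    using inner_laws assms by blast
  then show ?thesis
    using assms by (simp add: ip_eq_rip add_mem)
qed

lemma rip_scale:
  assumes "x \<in> X" "z \<in> X"
  shows "rip (\<lambda>k. c * x k) z = c * rip x z"
proof -
  have "ip (\<lambda>k. c * x k) z = ereal c * ip x z"
    using inner_laws assms by blast
  then show ?thesis
    using assms by (simp add: ip_eq_rip scale_mem)
qed

lemma linear_combination: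
  assumes "finite I" "\<And>i. i \<in> I \<Longrightarrow> x i \<in> X"
  shows sum_mem: "(\<lambda>k. \<Sum>i\<in>I. c i * x i k) \<in> X"
    and rip_sum: "z \<in> X \<Longrightarrow> rip (\<lambda>k. \<Sum>i\<in>I. c i * x i k) z = (\<Sum>i\<in>I. c i * rip (x i) z)"
proof -
  \<comment> \<open>Both claims go through one induction, because additivity of \<open>rip\<close>
    asks for membership of the partial sum.\<close>
  have "(\<lambda>k. \<Sum>i\<in>I. c i * x i k) \<in> X \<and>
    (z \<in> X \<longrightarrow> rip (\<lambda>k. \<Sum>i\<in>I. c i * x i k) z = (\<Sum>i\<in>I. c i * rip (x i) z))" for z
    using assms
  proof (induction I rule: finite_induct)
    case empty
    \<comment> \<open>The zero sequence is 0 times itself, so homogeneity makes its inner products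
      vanish.\<close>
    then show ?case using zero_mem rip_scale[of "\<lambda>k. 0" z 0] by simp
  next
    case (insert i I)
    then show ?case
      by (simp add: add_mem scale_mem rip_add rip_scale)
  qed
  then show "(\<lambda>k. \<Sum>i\<in>I. c i * x i k) \<in> X"
    and "z \<in> X \<Longrightarrow> rip (\<lambda>k. \<Sum>i\<in>I. c i * x i k) z = (\<Sum>i\<in>I. c i * rip (x i) z)"
    by auto
qed

text \<open>Factoring \<open>A\<close> as a Gram matrix turns the sum into a sum of squared norms of
  the signals \<open>z l\<close>, each a linear combination of the \<open>x i\<close>. This carries
  semidefiniteness from real vectors over to signals.\<close>

lemma psd_rip_nonneg:
  assumes "finite I" and x: "\<And>i. i \<in> I \<Longrightarrow> x i \<in> X"
    and "\<And>i j. i \<in> I \<Longrightarrow> j \<in> I \<Longrightarrow> A i j = A j i"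
    and "\<And>v. 0 \<le> (\<Sum>i\<in>I. \<Sum>j\<in>I. A i j * v i * v j)"
  shows "0 \<le> (\<Sum>i\<in>I. \<Sum>j\<in>I. A i j * rip (x i) (x j))"
proof -
  obtain L where L: "\<And>i j. i \<in> I \<Longrightarrow> j \<in> I \<Longrightarrow> A i j = (\<Sum>l\<in>I. L l i * L l j)"
    using psd_imp_gram[of I A] assms by blast
  define z where "z l = (\<lambda>k. \<Sum>i\<in>I. L l i * x i k)" for l
  have z: "z l \<in> X" for l
    unfolding z_def using assms by (intro sum_mem)
  have "rip (z l) (z l) = (\<Sum>i\<in>I. \<Sum>j\<in>I. L l i * L l j * rip (x i) (x j))" for l
  proof -
    have "rip (z l) (z l) = (\<Sum>i\<in>I. L l i * rip (x i) (z l))"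
      using rip_sum[of I x "z l" "L l"] assms z by (simp add: z_def)
    also have "\<dots> = (\<Sum>i\<in>I. L l i * (\<Sum>j\<in>I. L l j * rip (x j) (x i)))"
    proof (rule sum.cong)
      fix i assume "i \<in> I"
      then have "rip (x i) (z l) = rip (z l) (x i)"
        using x z by (intro rip_commute)
      also have "\<dots> = (\<Sum>j\<in>I. L l j * rip (x j) (x i))"
        unfolding z_def using assms \<open>i \<in> I\<close> by (intro rip_sum) auto
      finally show "L l i * rip (x i) (z l) = L l i * (\<Sum>j\<in>I. L l j * rip (x j) (x i))"
        by simp
    qed simp
    also have "\<dots> = (\<Sum>i\<in>I. \<Sum>j\<in>I. L l i * L l j * rip (x i) (x j))"
      unfolding sum_distrib_left using x by (intro sum.cong) (auto simp: rip_commute mult_ac)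
    finally show ?thesis .
  qed
  then have "(\<Sum>l\<in>I. rip (z l) (z l)) = (\<Sum>l\<in>I. \<Sum>i\<in>I. \<Sum>j\<in>I. L l i * L l j * rip (x i) (x j))"
    by simp
  \<comment> \<open>The sum over \<open>l\<close> is moved innermost in two swaps, where it
    collapses to \<open>A i j\<close>.\<close>
  also have "\<dots> = (\<Sum>i\<in>I. \<Sum>l\<in>I. \<Sum>j\<in>I. L l i * L l j * rip (x i) (x j))"
    by (rule sum.swap)
  also have "\<dots> = (\<Sum>i\<in>I. \<Sum>j\<in>I. \<Sum>l\<in>I. L l i * L l j * rip (x i) (x j))"
    by (intro sum.cong refl sum.swap)
  also have "\<dots> = (\<Sum>i\<in>I. \<Sum>j\<in>I. A i j * rip (x i) (x j))"
    by (intro sum.cong refl) (simp add: L sum_distrib_right)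
  finally have "(\<Sum>i\<in>I. \<Sum>j\<in>I. A i j * rip (x i) (x j)) = (\<Sum>l\<in>I. rip (z l) (z l))" by simp
  also have "\<dots> \<ge> 0" by (intro sum_nonneg rip_nonneg z)
  finally show ?thesis .
qed

section \<open>Pointwise bound for the supply rate of vector signals\<close>

definition vnorm2 :: "(int \<Rightarrow> real^'n) \<Rightarrow> real" where
  "vnorm2 x = (\<Sum>i\<in>UNIV. rip (component i x) (component i x))"

lemma vnorm2_nonneg: "x \<in> vec_seqs X \<Longrightarrow> 0 \<le> vnorm2 x"
  by (auto simp: vnorm2_def vec_seqs_def intro!: sum_nonneg rip_nonneg)

lemma vec_sq_norm_eq: "x \<in> vec_seqs X \<Longrightarrow> vec_sq_norm X ip x = ereal (vnorm2 x)"
  by (simp add: vec_sq_norm_def vnorm2_def vec_seqs_def sq_norm_def ip_eq_rip)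

lemma component_stack:
  "component (Inl a) (stack y u) = component a y"
  "component (Inr b) (stack y u) = component b u"
  by (auto simp: component_def stack_def)

lemma stack_mem:
  assumes "y \<in> vec_seqs X" "u \<in> vec_seqs X"
  shows "component i (stack y u) \<in> X"
  using assms by (cases i) (auto simp: component_stack vec_seqs_def)

text \<open>The matrix acts pointwise in time, so each component of its image is a fixed linear
  combination of the components of the stacked signal, and linearity pulls the entries out of the
  inner product.\<close>

lemma supply_rate_eq:
  assumes "y \<in> vec_seqs X" "u \<in> vec_seqs X"
  shows "supply_rate ip Q S R y u = ereal (\<Sum>i\<in>UNIV. \<Sum>j\<in>UNIV. supply_matrix Q S R $ i $ j *
    rip (component i (stack y u)) (component j (stack y u)))"
proof -
  let ?x = "\<lambda>i. component i (stack y u)"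
  let ?z = "\<lambda>i. \<lambda>k. \<Sum>j\<in>UNIV. supply_matrix Q S R $ i $ j * ?x j k"
  note mem = stack_mem[OF assms]
  have "component i (\<lambda>k. supply_matrix Q S R *v stack y u k) = ?z i" for i
    by (auto simp: component_def matrix_vector_mult_def)
  moreover have "ip (?x i) (?z i) =
      ereal (\<Sum>j\<in>UNIV. supply_matrix Q S R $ i $ j * rip (?x i) (?x j))" for i
  proof -
    have zi: "?z i \<in> X" by (intro sum_mem mem) simp
    have "rip (?x i) (?z i) = rip (?z i) (?x i)"
      using mem zi by (intro rip_commute)
    also have "\<dots> = (\<Sum>j\<in>UNIV. supply_matrix Q S R $ i $ j * rip (?x j) (?x i))"
      by (intro rip_sum mem) simp
    also have "\<dots> = (\<Sum>j\<in>UNIV. supply_matrix Q S R $ i $ j * rip (?x i) (?x j))"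
      using mem by (intro sum.cong) (auto simp: rip_commute)
    finally show ?thesis using ip_eq_rip[OF mem zi] by simp
  qed
  ultimately show ?thesis
    by (simp add: supply_rate_def vec_inner_def)
qed

text \<open>The domination of quadratic forms is transferred to signals by
  \<open>psd_rip_nonneg\<close>. The constants are fixed before \<open>y\<close> and
  \<open>u\<close>, which makes the later gain uniform in input, time and samples.\<close>

lemma supply_rate_bound:
  fixes Q :: "real^'m^'m" and S :: "real^'n^'m" and R :: "real^'n^'n"
  assumes "symmetric_matrix R" "negative_definite Q"
  obtains c C where "c > 0" "C > 0"
    "\<And>y u. y \<in> vec_seqs X \<Longrightarrow> u \<in> vec_seqs X \<Longrightarrow>
       real_of_ereal (supply_rate ip Q S R y u) \<le> C * vnorm2 u - c * vnorm2 y"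
proof -
  obtain c C where cC: "c > 0" "C > 0" and dom:
    "\<And>v. (\<Sum>i\<in>UNIV. \<Sum>j\<in>UNIV. supply_matrix Q S R $ i $ j * v i * v j)
       \<le> (\<Sum>i\<in>UNIV. (case i of Inl _ \<Rightarrow> - c | Inr _ \<Rightarrow> C) * (v i)\<^sup>2)"
    using supply_matrix_dominated[OF assms(2)] by blast
  define d where "d i = (case i of Inl _ \<Rightarrow> - c | Inr _ \<Rightarrow> C)" for i :: "'m + 'n"
  \<comment> \<open>The slack of the domination: the block diagonal bound minus the supply matrix, a
    positive semidefinite matrix.\<close>
  define A where "A i j = (if i = j then d i else 0) - supply_matrix Q S R $ i $ j" for i j
  have A_sum: "(\<Sum>i\<in>UNIV. \<Sum>j\<in>UNIV. A i j * f i j) = (\<Sum>i\<in>UNIV. d i * f i i) -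
      (\<Sum>i\<in>UNIV. \<Sum>j\<in>UNIV. supply_matrix Q S R $ i $ j * f i j)" for f
    by (simp add: A_def left_diff_distrib sum_subtractf if_distrib[of "\<lambda>x. x * _"] cong: if_cong)
  have A_sym: "A i j = A j i" for i j
    using supply_matrix_symmetric[of Q R S i j] assms by (simp add: A_def negative_definite_def)
  have A_psd: "0 \<le> (\<Sum>i\<in>UNIV. \<Sum>j\<in>UNIV. A i j * v i * v j)" for v
    using dom[of v] A_sum[of "\<lambda>i j. v i * v j"]
    by (simp add: d_def power2_eq_square mult.assoc)
  have "real_of_ereal (supply_rate ip Q S R y u) \<le> C * vnorm2 u - c * vnorm2 y"
    if "y \<in> vec_seqs X" "u \<in> vec_seqs X" for y u
  proof -
    let ?x = "\<lambda>i. component i (stack y u)"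
    have "0 \<le> (\<Sum>i\<in>UNIV. \<Sum>j\<in>UNIV. A i j * rip (?x i) (?x j))"
      using stack_mem[OF that] A_sym A_psd by (intro psd_rip_nonneg) auto
    also have "\<dots> = (\<Sum>i\<in>UNIV. d i * rip (?x i) (?x i)) - real_of_ereal (supply_rate ip Q S R y u)"
      by (simp add: A_sum supply_rate_eq[OF that])
    also have "(\<Sum>i\<in>UNIV. d i * rip (?x i) (?x i)) = C * vnorm2 u - c * vnorm2 y"
      by (simp add: sum_UNIV_Plus d_def component_stack vnorm2_def sum_distrib_left sum_negf)
    finally show ?thesis by simp
  qed
  with cC show ?thesis by (rule that)
qed

text \<open>\<open>sq_norm\<close> is infinite outside \<open>X\<close>, so a finite norm of the
  truncation forces membership.\<close>

lemma trunc_mem: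
  assumes "x \<in> vec_seqs (extension X ip)" "T \<ge> 0"
  shows "trunc T x \<in> vec_seqs X"
proof -
  have "component i (trunc T x) = trunc T (component i x)" for i
    by (auto simp: component_def trunc_def)
  moreover have "trunc T (component i x) \<in> X" for i
    using assms by (force simp: vec_seqs_def extension_def sq_norm_def split: if_splits)
  ultimately show ?thesis by (simp add: vec_seqs_def)
qed

end

section \<open>Stability by taking expectations\<close>

theorem theorem1:
  fixes X :: "(int \<Rightarrow> real) set"
    and ip :: "(int \<Rightarrow> real) \<Rightarrow> (int \<Rightarrow> real) \<Rightarrow> ereal"
    and P :: "'w measure"
    and N :: "'o measure"
    and W :: "nat \<Rightarrow> 'o \<Rightarrow> 'w"
    and Q :: "real^'m^'m"
    and S :: "real^'n^'m"
    and R :: "real^'n^'n"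
    and G :: "(int \<Rightarrow> real^'n) \<Rightarrow> 'w list \<Rightarrow> int \<Rightarrow> real^'m"
  assumes "seq_inner_space X ip"
    and "complete_seq_space X ip"
    and "X \<subseteq> extension X ip"
    and "prob_space P" and "complete_measure P"
    and "iid_samples N P W"
    and "symmetric_matrix Q" and "symmetric_matrix R"
    and "\<forall>u \<in> vec_seqs (extension X ip). \<forall>w \<in> lists (space P).
           G u w \<in> vec_seqs (extension X ip)"
    and "\<forall>u \<in> vec_seqs X. \<forall>T>0.
           (\<lambda>\<omega>. vec_sq_norm X ip (trunc_output G W u T \<omega>)) \<in> borel_measurable N"
    and "stoch_dissipative X ip N W Q S R G"
    and "negative_definite Q"
  shows "stoch_io_stable X ip N W G"
proof -
  interpret complete_sequence_space X ip
    by unfold_locales fact+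
  have "prob_space N" and W: "\<And>i. W i \<in> measurable N P"
    using assms(6) by (auto simp: iid_samples_def)
  then interpret N: prob_space N by simp
  obtain c C where cC: "c > 0" "C > 0" and bound:
    "\<And>y u. y \<in> vec_seqs X \<Longrightarrow> u \<in> vec_seqs X \<Longrightarrow>
       real_of_ereal (supply_rate ip Q S R y u) \<le> C * vnorm2 u - c * vnorm2 y"
    using supply_rate_bound[OF assms(8,12)] by blast
  \<comment> \<open>Stability tests inputs in \<open>X\<close>, dissipativity inputs in the
    extension; the assumed inclusion links the two.\<close>
  have ext: "u \<in> vec_seqs (extension X ip)" if "u \<in> vec_seqs X" for u :: "int \<Rightarrow> real^'n"
    using that assms(3) by (auto simp: vec_seqs_def)
  obtain \<beta> where diss: "\<And>T u. T > 0 \<Longrightarrow> u \<in> vec_seqs (extension X ip) \<Longrightarrow>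
      integrable N (\<lambda>\<omega>. real_of_ereal (supply_rate ip Q S R (trunc_output G W u T \<omega>) (trunc T u))) \<and>
      \<beta> \<le> (\<integral>\<omega>. real_of_ereal (supply_rate ip Q S R (trunc_output G W u T \<omega>) (trunc T u)) \<partial>N)"
    using assms(11) unfolding stoch_dissipative_def by blast
  \<comment> \<open>Gain and bias come from dividing the expected pointwise bound by
    \<open>c\<close> and inserting the lower bound \<open>\<beta>\<close> on the expected
    supply.\<close>
  have "enn2ereal (\<integral>\<^sup>+\<omega>. e2ennreal (vec_sq_norm X ip (trunc_output G W u T \<omega>)) \<partial>N)
      \<le> ereal (C / c) * vec_sq_norm X ip (trunc T u) + ereal (- \<beta> / c)"
    if u: "u \<in> vec_seqs X" and T: "T > 0" for u T
  proof -
    let ?y = "trunc_output G W u T" and ?u = "trunc T u"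
    let ?s = "\<lambda>\<omega>. real_of_ereal (supply_rate ip Q S R (?y \<omega>) ?u)"
    let ?g = "\<lambda>\<omega>. (C * vnorm2 ?u - ?s \<omega>) / c"
    have s: "integrable N ?s" "\<beta> \<le> (\<integral>\<omega>. ?s \<omega> \<partial>N)"
      using diss[OF T ext[OF u]] by auto
    have mem_u: "?u \<in> vec_seqs X"
      using trunc_mem[OF ext[OF u]] T by simp
    \<comment> \<open>\<open>G\<close> is controlled only on sample lists from
      \<open>space P\<close>, which measurability of \<open>W\<close> guarantees for outcomes in
      \<open>space N\<close>.\<close>
    have mem_y: "?y \<omega> \<in> vec_seqs X" if "\<omega> \<in> space N" for \<omega>
    proof -
      have "samples_upto W T \<omega> \<in> lists (space P)"
        using measurable_space[OF W that] by (auto simp: samples_upto_def)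
      then show ?thesis
        unfolding trunc_output_def using assms(9) ext[OF mem_u] T by (intro trunc_mem) auto
    qed
    have le_g: "vnorm2 (?y \<omega>) \<le> ?g \<omega>" if "\<omega> \<in> space N" for \<omega>
      using bound[OF mem_y[OF that] mem_u] cC by (simp add: field_simps)
    \<comment> \<open>Nonnegativity lets the integral of the majorant in
      \<open>[0, \<infinity>]\<close> be computed as a Bochner integral.\<close>
    have g_nonneg: "0 \<le> ?g \<omega>" if "\<omega> \<in> space N" for \<omega>
      using le_g[OF that] vnorm2_nonneg[OF mem_y[OF that]] by simp
    have "(\<integral>\<^sup>+\<omega>. e2ennreal (vec_sq_norm X ip (?y \<omega>)) \<partial>N) \<le> (\<integral>\<^sup>+\<omega>. ennreal (?g \<omega>) \<partial>N)"
      by (intro nn_integral_mono) (auto simp: vec_sq_norm_eq[OF mem_y] intro!: ennreal_leI le_g)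
    also have "\<dots> = ennreal (\<integral>\<omega>. ?g \<omega> \<partial>N)"
      using s(1) g_nonneg by (intro nn_integral_eq_integral) auto
    also have "(\<integral>\<omega>. ?g \<omega> \<partial>N) = (C * vnorm2 ?u - (\<integral>\<omega>. ?s \<omega> \<partial>N)) / c"
      using s(1) by (simp add: N.prob_space)
    finally have "enn2ereal (\<integral>\<^sup>+\<omega>. e2ennreal (vec_sq_norm X ip (?y \<omega>)) \<partial>N)
        \<le> enn2ereal (ennreal ((C * vnorm2 ?u - (\<integral>\<omega>. ?s \<omega> \<partial>N)) / c))"
      by (simp add: less_eq_ennreal.rep_eq)
    also have "\<dots> = ereal ((C * vnorm2 ?u - (\<integral>\<omega>. ?s \<omega> \<partial>N)) / c)"
    \<comment> \<open>\<open>enn2ereal\<close> undoes \<open>ennreal\<close> only on nonnegative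
      reals, so the sign of the expected majorant has to be established.\<close>
    proof -
      have "0 \<le> (\<integral>\<omega>. ?g \<omega> \<partial>N)"
        using g_nonneg by (intro integral_nonneg_AE) auto
      then show ?thesis
        using s(1) by (intro enn2ereal_ennreal) (simp add: N.prob_space)
    qed
    also have "\<dots> \<le> ereal (C / c * vnorm2 ?u + - \<beta> / c)"
      using s(2) cC by (simp add: field_simps)
    finally show ?thesis
      by (simp add: vec_sq_norm_eq[OF mem_u])
  qed
  then show ?thesis
    unfolding stoch_io_stable_def using cC by (intro exI[of _ "- \<beta> / c"] exI[of _ "C / c"]) simp
qed

end
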